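(* Let $A=\{x\in\mathbb{R}^2 : 1\le \|x\|\le 1+\sqrt 2\}$, where $\|\cdot\|$ is the Euclidean norm. Suppose that $\gamma:S^1\to A$ is a continuous closed curve in $A$ that represents a generator of $\pi_1(A)\cong\mathbb{Z}$. Then $\gamma$ inscribes a square of side length at least $\sqrt 2$.
   Context: A curve $\gamma:S^1\to\mathbb{R}^2$ (not necessarily injective or smooth) inscribes a square if its image $\gamma(S^1)$ contains the four vertices of a non-degenerate square in $\mathbb{R}^2$; the square need not lie inside the curve. *)

theory Defs
  imports "HOL-Analysis.Analysis" "HOL-Algebra.Generated_Groups"
begin

section \<open>The fundamental group\<close>

definition loops_at :: "'a::topological_space set \<Rightarrow> 'a \<Rightarrow> (real \<Rightarrow> 'a) set" where
  "loops_at S a = {p. path p \<and> path_image p \<subseteq> S \<and> pathstart p = a \<and> pathfinish p = a}"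

definition homotopy_class :: "'a::topological_space set \<Rightarrow> (real \<Rightarrow> 'a) \<Rightarrow> (real \<Rightarrow> 'a) set" where
  "homotopy_class S p = {q. homotopic_paths S p q}"

text \<open>The product is the class of the concatenation of representatives, written without a
  choice of representatives: see \<open>fundamental_group_mult_class\<close> below.\<close>

definition fundamental_group ::
    "'a::real_normed_vector set \<Rightarrow> 'a \<Rightarrow> (real \<Rightarrow> 'a) set monoid" where
  "fundamental_group S a =
     \<lparr>carrier = homotopy_class S ` loops_at S a,
      monoid.mult = (\<lambda>X Y. \<Union>p\<in>X. \<Union>q\<in>Y. homotopy_class S (p +++ q)),
      one = homotopy_class S (linepath a a)\<rparr>"

lemma homotopy_class_eq_iff:
  assumes "p \<in> loops_at S a"
  shows "homotopy_class S p = homotopy_class S q \<longleftrightarrow> homotopic_paths S p q"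
proof
  assume "homotopy_class S p = homotopy_class S q"
  moreover have "p \<in> homotopy_class S p"
    using assms by (simp add: homotopy_class_def loops_at_def)
  ultimately show "homotopic_paths S p q"
    by (simp add: homotopy_class_def homotopic_paths_sym)
next
  assume "homotopic_paths S p q"
  then show "homotopy_class S p = homotopy_class S q"
    unfolding homotopy_class_def
    by (blast intro: homotopic_paths_trans homotopic_paths_sym)
qed

lemma loops_at_join:
  "p \<in> loops_at S a \<Longrightarrow> q \<in> loops_at S a \<Longrightarrow> p +++ q \<in> loops_at S a"
  by (auto simp: loops_at_def path_image_join)

lemma fundamental_group_mult_class:
  assumes "p \<in> loops_at S a" "q \<in> loops_at S a"
  shows "homotopy_class S p \<otimes>\<^bsub>fundamental_group S a\<^esub> homotopy_class S q
       = homotopy_class S (p +++ q)"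
proof -
  have same: "homotopy_class S (p' +++ q') = homotopy_class S (p +++ q)"
    if "p' \<in> homotopy_class S p" "q' \<in> homotopy_class S q" for p' q'
  proof -
    have "homotopic_paths S (p +++ q) (p' +++ q')"
      using that assms
      by (intro homotopic_paths_join) (auto simp: homotopy_class_def loops_at_def)
    then show ?thesis
      using homotopy_class_eq_iff[OF loops_at_join[OF assms]] by metis
  qed
  have "p \<in> homotopy_class S p" "q \<in> homotopy_class S q"
    using assms by (simp_all add: homotopy_class_def loops_at_def)
  with same have "(\<Union>p'\<in>homotopy_class S p. \<Union>q'\<in>homotopy_class S q. homotopy_class S (p' +++ q'))
      = homotopy_class S (p +++ q)"
    by blast
  then show ?thesis
    by (simp add: fundamental_group_def)
qed

lemma group_fundamental_group:
  assumes "a \<in> S"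
  shows "group (fundamental_group S a)"
proof -
  let ?G = "fundamental_group S a"
  have carr: "carrier ?G = homotopy_class S ` loops_at S a"
    and one: "\<one>\<^bsub>?G\<^esub> = homotopy_class S (linepath a a)"
    by (simp_all add: fundamental_group_def)
  have const: "linepath a a \<in> loops_at S a"
    using assms by (simp add: loops_at_def)
  show ?thesis
  proof (rule groupI)
    fix X Y assume "X \<in> carrier ?G" "Y \<in> carrier ?G"
    then show "X \<otimes>\<^bsub>?G\<^esub> Y \<in> carrier ?G"
      unfolding carr by (auto simp: fundamental_group_mult_class loops_at_join)
  next
    show "\<one>\<^bsub>?G\<^esub> \<in> carrier ?G"
      unfolding carr one using const by blast
  next
    fix X Y Z assume "X \<in> carrier ?G" "Y \<in> carrier ?G" "Z \<in> carrier ?G"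
    then obtain p q r where
      *: "p \<in> loops_at S a" "q \<in> loops_at S a" "r \<in> loops_at S a"
      and eqs: "X = homotopy_class S p" "Y = homotopy_class S q" "Z = homotopy_class S r"
      unfolding carr by blast
    have "homotopic_paths S ((p +++ q) +++ r) (p +++ (q +++ r))"
      using * by (intro homotopic_paths_sym[OF homotopic_paths_assoc]) (auto simp: loops_at_def)
    then have "homotopy_class S ((p +++ q) +++ r) = homotopy_class S (p +++ (q +++ r))"
      using * by (subst homotopy_class_eq_iff[where a = a]) (auto intro: loops_at_join)
    then show "X \<otimes>\<^bsub>?G\<^esub> Y \<otimes>\<^bsub>?G\<^esub> Z = X \<otimes>\<^bsub>?G\<^esub> (Y \<otimes>\<^bsub>?G\<^esub> Z)"
      unfolding eqs using * by (simp add: fundamental_group_mult_class loops_at_join)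
  next
    fix X assume "X \<in> carrier ?G"
    then obtain p where p: "p \<in> loops_at S a" and X: "X = homotopy_class S p"
      unfolding carr by blast
    have "homotopic_paths S (linepath a a +++ p) p"
      using p by (intro homotopic_paths_lid') (auto simp: loops_at_def)
    then have "homotopy_class S (linepath a a +++ p) = homotopy_class S p"
      using homotopy_class_eq_iff[OF loops_at_join[OF const p]] by blast
    then show "\<one>\<^bsub>?G\<^esub> \<otimes>\<^bsub>?G\<^esub> X = X"
      unfolding X one using p const by (simp add: fundamental_group_mult_class)
    have p': "reversepath p \<in> loops_at S a"
      using p by (simp add: loops_at_def)
    have "homotopic_paths S (reversepath p +++ p) (linepath a a)"
      using p homotopic_paths_linv[of p S] by (auto simp: loops_at_def)
    then have "homotopy_class S (reversepath p +++ p) = homotopy_class S (linepath a a)"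
      using homotopy_class_eq_iff[OF loops_at_join[OF p' p]] by blast
    then have "homotopy_class S (reversepath p) \<otimes>\<^bsub>?G\<^esub> X = \<one>\<^bsub>?G\<^esub>"
      unfolding X one using p p' by (simp add: fundamental_group_mult_class)
    then show "\<exists>Y\<in>carrier ?G. Y \<otimes>\<^bsub>?G\<^esub> X = \<one>\<^bsub>?G\<^esub>"
      unfolding carr using p' by blast
  qed
qed

section \<open>Closed curves\<close>

text \<open>A closed curve is a map on the unit circle \<open>sphere 0 1\<close> of the complex plane; its
  values elsewhere are irrelevant.  The associated loop is based at \<open>\<gamma> 1\<close>.\<close>

definition loop_of_curve :: "(complex \<Rightarrow> 'a) \<Rightarrow> real \<Rightarrow> 'a" where
  "loop_of_curve \<gamma> t = \<gamma> (cis (2 * pi * t))"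

definition represents_generator :: "'a::real_normed_vector set \<Rightarrow> (complex \<Rightarrow> 'a) \<Rightarrow> bool" where
  "represents_generator S \<gamma> \<longleftrightarrow>
     generate (fundamental_group S (\<gamma> 1)) {homotopy_class S (loop_of_curve \<gamma>)}
       = carrier (fundamental_group S (\<gamma> 1))"

lemma loop_of_curve_in_loops_at:
  assumes "continuous_on (sphere 0 1) \<gamma>" "\<gamma> ` sphere 0 1 \<subseteq> S"
  shows "loop_of_curve \<gamma> \<in> loops_at S (\<gamma> 1)"
proof -
  have "continuous_on {0..1} (\<lambda>t. cis (2 * pi * t))"
    by (intro continuous_intros)
  moreover have "(\<lambda>t. cis (2 * pi * t)) ` {0..1} \<subseteq> sphere 0 1"
    by auto
  ultimately have "continuous_on {0..1} (loop_of_curve \<gamma>)"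
    unfolding loop_of_curve_def by (rule continuous_on_compose2[OF assms(1)])
  moreover have "loop_of_curve \<gamma> t \<in> S" for t
    using assms(2) by (simp add: loop_of_curve_def image_subset_iff)
  moreover have "loop_of_curve \<gamma> 0 = \<gamma> 1" "loop_of_curve \<gamma> 1 = \<gamma> 1"
    by (simp_all add: loop_of_curve_def)
  ultimately show ?thesis
    unfolding loops_at_def path_def path_image_def pathstart_def pathfinish_def by blast
qed

section \<open>Inscribed squares\<close>

text \<open>The vertices are listed in cyclic order.  Positivity of the side length \<open>l\<close>
  is the non-degeneracy of the square.\<close>

definition is_square :: "real ^ 2 \<Rightarrow> real ^ 2 \<Rightarrow> real ^ 2 \<Rightarrow> real ^ 2 \<Rightarrow> real \<Rightarrow> bool" where
  "is_square a b c d l \<longleftrightarrow>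
     l > 0 \<and> dist a b = l \<and> dist a d = l \<and> (b - a) \<bullet> (d - a) = 0 \<and> c - d = b - a"

definition inscribes_square :: "(complex \<Rightarrow> real ^ 2) \<Rightarrow> real \<Rightarrow> bool" where
  "inscribes_square \<gamma> l \<longleftrightarrow>
     (\<exists>a b c d. is_square a b c d l \<and> {a, b, c, d} \<subseteq> \<gamma> ` sphere 0 1)"

end

theory Submission
  imports Defs "HOL-Library.Z2" "HOL-Complex_Analysis.Winding_Numbers"
begin

text \<open>
  In the complex plane, the square with centre \<open>c\<close> and half diagonal \<open>v\<close> has the vertices
  \<open>c + \<i> ^ k * v\<close>. Replacing \<open>v\<close> by \<open>\<i> * v\<close> only renumbers them. Writing \<open>c = v * w\<close>, call the
  square \<^emph>\<open>large\<close> if \<open>norm w \<le> 1\<close>. The width of the annulus enters through one fact: if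
  \<open>norm w = 1\<close>, then the distances of the vertices from the origin are \<open>norm v\<close> times
  \<open>sqrt (2 \<plusminus> 2 * cos \<delta>)\<close> and \<open>sqrt (2 \<plusminus> 2 * sin \<delta>)\<close> with \<open>\<bar>\<delta>\<bar> \<le> pi / 4\<close>, so the largest is at least
  \<open>1 + sqrt 2\<close> times the smallest (\<open>norm_vertex_2_less_1\<close>). Hence a large square with vertices in the
  annulus cannot leave the set of large squares under a deformation inside the open annulus, and the
  number of large inscribed squares, modulo renumbering, has a well-defined parity, which is odd as
  for a circle about the origin. A large square has side at least \<open>sqrt 2\<close>, because its vertex nearest
  to the origin has norm at most \<open>norm v\<close> (\<open>norm_vertex_2_le\<close>).

  The curve enters only through its image \<open>K\<close>. As the curve generates the fundamental group, its
  winding number about \<open>0\<close> cannot vanish (\<open>winding_number_zero_if_generated\<close>), so \<open>0\<close> lies in a bounded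
  component of the complement of \<open>K\<close>. The distance from \<open>K\<close>, with a minus sign on that component, is a
  continuous function \<open>\<phi>\<close> that vanishes only on \<open>K\<close>, is negative on the open unit disc and is
  nonnegative outside the disc of radius \<open>1 + sqrt 2\<close>. It remains to find a large square whose four
  vertices are zeros of such a \<open>\<phi>\<close> (\<open>square_of_zeros\<close>).

  The parity argument for this is a version of Sperner's lemma. The large squares up to renumbering
  are parametrised by a four-dimensional cube with the coordinates \<open>norm w\<close>, the argument of \<open>w\<close> in
  \<open>[- pi / 4, pi / 4]\<close>, the argument of \<open>v\<close>, and \<open>norm v\<close>. The label of a square is some \<open>k < 4\<close> for which
  \<open>\<phi>\<close> is negative at vertex \<open>k\<close>, or \<open>4\<close> if there is none. On a small simplex that carries all five
  labels, \<open>\<phi>\<close> is almost zero at all four vertices. Ties between several negative vertices are broken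
  in such a way that, on the boundary of the cube, the facets with labels \<open>0, 1, 2, 3\<close> are matched in
  pairs by the two gluings of its sides, with the exception of a single one at the smallest squares
  (\<open>twisted_sperner\<close>).
\<close>

section \<open>A parity lemma for labelled cubes\<close>

text \<open>Numbers of simplices are counted modulo 2, as elements of type \<open>bit\<close>, so that pairs cancel by
  algebra. A door is a tetrahedron that carries exactly the labels \<open>0, 1, 2, 3\<close>.\<close>

definition door :: "nat \<Rightarrow> nat \<Rightarrow> nat \<Rightarrow> nat \<Rightarrow> bit" where
  "door a b c d = of_bool ({a, b, c, d} = {0, 1, 2, 3})"

text \<open>The parity of the number of doors among the facets of a 4-simplex.\<close>

definition doors :: "nat \<Rightarrow> nat \<Rightarrow> nat \<Rightarrow> nat \<Rightarrow> nat \<Rightarrow> bit" where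
  "doors a b c d e = door b c d e + door a c d e + door a b d e + door a b c e + door a b c d"

lemma door_eq_0_if_repeated:
  "door a a c d = 0" "door a b b d = 0" "door a b c c = 0"
  "door a b a d = 0" "door a b c b = 0" "door a b c a = 0"
proof -
  have "{x, y, z} \<noteq> {0, 1, 2, 3}" for x y z :: nat
    using card_length[of "[x, y, z]"] by fastforce
  then show "door a a c d = 0" "door a b b d = 0" "door a b c c = 0"
    "door a b a d = 0" "door a b c b = 0" "door a b c a = 0"
    unfolding door_def by (simp_all add: insert_absorb2 insert_commute)
qed

lemma door_commute:
  "door b a c d = door a b c d" "door a c b d = door a b c d" "door a b d c = door a b c d"
  by (simp_all add: door_def insert_commute)

lemma door_eq_0_if_no_0: "a \<noteq> 0 \<Longrightarrow> b \<noteq> 0 \<Longrightarrow> c \<noteq> 0 \<Longrightarrow> d \<noteq> 0 \<Longrightarrow> door a b c d = 0"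
  by (auto simp: door_def)

lemma door_ne_0D: "door a b c d \<noteq> 0 \<Longrightarrow> {a, b, c, d} \<subseteq> S \<Longrightarrow> {0, 1, 2, 3} \<subseteq> S"
  unfolding door_def by (metis of_bool_eq(1))

lemma bit_self: "x + x = (0::bit)" "x + (x + y) = (y::bit)"
  by (cases x; cases y; simp)+

text \<open>A 4-simplex with some door but without the label 4 has a repeated label, and the two facets
  opposite to the repeated vertices are both doors.\<close>

lemma all_labels_if_doors_odd:
  assumes odd: "doors a b c d e \<noteq> 0"
    and le: "{a, b, c, d, e} \<subseteq> {..4}"
  shows "{a, b, c, d, e} = {..4}"
proof -
  have "{0, 1, 2, 3} \<subseteq> {a, b, c, d, e}"
  proof -
    have "door b c d e \<noteq> 0 \<or> door a c d e \<noteq> 0 \<or> door a b d e \<noteq> 0 \<or> door a b c e \<noteq> 0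
      \<or> door a b c d \<noteq> 0"
      using odd unfolding doors_def by auto
    then show ?thesis
      by (elim disjE) (erule door_ne_0D, simp)+
  qed
  moreover have "4 \<in> {a, b, c, d, e}"
  proof (rule ccontr)
    assume "4 \<notin> {a, b, c, d, e}"
    then have "{a, b, c, d, e} \<subseteq> {..4} - {4}"
      using le by (simp only: subset_Diff_insert Diff_empty) blast
    also have "{..4} - {4} = {..<4::nat}"
      by auto
    finally have sub: "set [a, b, c, d, e] \<subseteq> {..<4}"
      by (simp only: list.set)
    have "card (set [a, b, c, d, e]) \<le> 4"
      using card_mono[OF _ sub] by simp
    then have "\<not> distinct [a, b, c, d, e]"
      using distinct_card[of "[a, b, c, d, e]"] by (simp only: list.size) linarith
    then consider "a = b" | "a = c" | "a = d" | "a = e" | "b = c" | "b = d" | "b = e"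
      | "c = d" | "c = e" | "d = e"
      by auto
    then have "doors a b c d e = 0"
      unfolding doors_def
      by cases (simp_all only: door_eq_0_if_repeated door_commute bit_self add_0_left add_0_right)
    with odd show False ..
  qed
  moreover have "{..4} = insert 4 {0, 1, 2, 3::nat}"
    by auto
  ultimately have "{..4} \<subseteq> {a, b, c, d, e}"
    by (simp only: insert_subset simp_thms)
  with le show ?thesis
    by (rule subset_antisym)
qed

text \<open>The unit cube is triangulated by the monotone paths from its lowest to its highest corner,
  one for each order of the coordinate directions. This triangulation is the restriction of
  the analogous one of the four-dimensional cube to its facets, and it is compatible with translations.\<close>

definition cube3 :: "(nat \<Rightarrow> nat \<Rightarrow> nat \<Rightarrow> nat) \<Rightarrow> bit" where
  "cube3 h = door (h 0 0 0) (h 1 0 0) (h 1 1 0) (h 1 1 1)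
     + door (h 0 0 0) (h 1 0 0) (h 1 0 1) (h 1 1 1)
     + door (h 0 0 0) (h 0 1 0) (h 1 1 0) (h 1 1 1)
     + door (h 0 0 0) (h 0 1 0) (h 0 1 1) (h 1 1 1)
     + door (h 0 0 0) (h 0 0 1) (h 1 0 1) (h 1 1 1)
     + door (h 0 0 0) (h 0 0 1) (h 0 1 1) (h 1 1 1)"

definition cube4 :: "(nat \<Rightarrow> nat \<Rightarrow> nat \<Rightarrow> nat \<Rightarrow> nat) \<Rightarrow> bit" where
  "cube4 h = doors (h 0 0 0 0) (h 1 0 0 0) (h 1 1 0 0) (h 1 1 1 0) (h 1 1 1 1)
     + doors (h 0 0 0 0) (h 1 0 0 0) (h 1 1 0 0) (h 1 1 0 1) (h 1 1 1 1)
     + doors (h 0 0 0 0) (h 1 0 0 0) (h 1 0 1 0) (h 1 1 1 0) (h 1 1 1 1)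
     + doors (h 0 0 0 0) (h 1 0 0 0) (h 1 0 1 0) (h 1 0 1 1) (h 1 1 1 1)
     + doors (h 0 0 0 0) (h 1 0 0 0) (h 1 0 0 1) (h 1 1 0 1) (h 1 1 1 1)
     + doors (h 0 0 0 0) (h 1 0 0 0) (h 1 0 0 1) (h 1 0 1 1) (h 1 1 1 1)
     + doors (h 0 0 0 0) (h 0 1 0 0) (h 1 1 0 0) (h 1 1 1 0) (h 1 1 1 1)
     + doors (h 0 0 0 0) (h 0 1 0 0) (h 1 1 0 0) (h 1 1 0 1) (h 1 1 1 1)
     + doors (h 0 0 0 0) (h 0 1 0 0) (h 0 1 1 0) (h 1 1 1 0) (h 1 1 1 1)
     + doors (h 0 0 0 0) (h 0 1 0 0) (h 0 1 1 0) (h 0 1 1 1) (h 1 1 1 1)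
     + doors (h 0 0 0 0) (h 0 1 0 0) (h 0 1 0 1) (h 1 1 0 1) (h 1 1 1 1)
     + doors (h 0 0 0 0) (h 0 1 0 0) (h 0 1 0 1) (h 0 1 1 1) (h 1 1 1 1)
     + doors (h 0 0 0 0) (h 0 0 1 0) (h 1 0 1 0) (h 1 1 1 0) (h 1 1 1 1)
     + doors (h 0 0 0 0) (h 0 0 1 0) (h 1 0 1 0) (h 1 0 1 1) (h 1 1 1 1)
     + doors (h 0 0 0 0) (h 0 0 1 0) (h 0 1 1 0) (h 1 1 1 0) (h 1 1 1 1)
     + doors (h 0 0 0 0) (h 0 0 1 0) (h 0 1 1 0) (h 0 1 1 1) (h 1 1 1 1)
     + doors (h 0 0 0 0) (h 0 0 1 0) (h 0 0 1 1) (h 1 0 1 1) (h 1 1 1 1)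
     + doors (h 0 0 0 0) (h 0 0 1 0) (h 0 0 1 1) (h 0 1 1 1) (h 1 1 1 1)
     + doors (h 0 0 0 0) (h 0 0 0 1) (h 1 0 0 1) (h 1 1 0 1) (h 1 1 1 1)
     + doors (h 0 0 0 0) (h 0 0 0 1) (h 1 0 0 1) (h 1 0 1 1) (h 1 1 1 1)
     + doors (h 0 0 0 0) (h 0 0 0 1) (h 0 1 0 1) (h 1 1 0 1) (h 1 1 1 1)
     + doors (h 0 0 0 0) (h 0 0 0 1) (h 0 1 0 1) (h 0 1 1 1) (h 1 1 1 1)
     + doors (h 0 0 0 0) (h 0 0 0 1) (h 0 0 1 1) (h 1 0 1 1) (h 1 1 1 1)
     + doors (h 0 0 0 0) (h 0 0 0 1) (h 0 0 1 1) (h 0 1 1 1) (h 1 1 1 1)"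

text \<open>The boundary of the triangulated cube. A tetrahedron in the interior arises from a path by
  leaving out an inner corner; exchanging the two steps next to that corner gives the same tetrahedron
  from another path, so these terms cancel. Leaving out the first or the last corner gives the
  tetrahedra on the upper and on the lower facets.\<close>

lemma cube4_boundary: "cube4 h =
     (cube3 (\<lambda>x y z. h 0 x y z) + cube3 (\<lambda>x y z. h 1 x y z))
   + (cube3 (\<lambda>x y z. h x 0 y z) + cube3 (\<lambda>x y z. h x 1 y z))
   + (cube3 (\<lambda>x y z. h x y 0 z) + cube3 (\<lambda>x y z. h x y 1 z))
   + (cube3 (\<lambda>x y z. h x y z 0) + cube3 (\<lambda>x y z. h x y z 1))"
  unfolding cube4_def cube3_def doors_def
  by (simp only: add.assoc add.commute add.left_commute bit_self add_0_left add_0_right)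

lemma cube3_cong:
  assumes "\<And>x y z. x \<le> 1 \<Longrightarrow> y \<le> 1 \<Longrightarrow> z \<le> 1 \<Longrightarrow> h x y z = h' x y z"
  shows "cube3 h = cube3 h'"
  using assms by (simp add: cube3_def)

lemma cube3_eq_0_if_no_0:
  assumes "\<And>x y z. x \<le> 1 \<Longrightarrow> y \<le> 1 \<Longrightarrow> z \<le> 1 \<Longrightarrow> h x y z \<noteq> 0"
  shows "cube3 h = 0"
  using assms by (simp add: cube3_def door_eq_0_if_no_0)

lemma cube3_eq_0_if_degenerate:
  assumes "\<And>x y z. x \<le> 1 \<Longrightarrow> y \<le> 1 \<Longrightarrow> z \<le> 1 \<Longrightarrow> h x y z = h 0 y z"
  shows "cube3 h = 0"
proof -
  have "cube3 h = cube3 (\<lambda>x. h 0)"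
    using assms by (rule cube3_cong)
  then show ?thesis
    by (simp add: cube3_def door_eq_0_if_repeated)
qed

text \<open>The effect on labels of replacing \<open>v\<close> by \<open>\<i> * v\<close>, which makes the old vertex \<open>k\<close> the new vertex
  \<open>k - 1\<close> modulo 4. Adding 3 avoids truncated subtraction.\<close>

definition shift_label :: "nat \<Rightarrow> nat" where
  "shift_label k = (if k = 4 then 4 else (k + 3) mod 4)"

lemma door_shift_label:
  assumes "{a, b, c, d} \<subseteq> {..4}"
  shows "door (shift_label a) (shift_label b) (shift_label c) (shift_label d) = door a b c d"
proof -
  have 4: "{..4} = {0, 1, 2, 3, 4::nat}" by auto
  have inj: "inj_on shift_label {..4}"
    unfolding 4 by (simp add: shift_label_def)
  have im: "shift_label ` {0, 1, 2, 3} = {0, 1, 2, 3}"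
    by (simp add: shift_label_def) auto
  have "shift_label ` {a, b, c, d} = shift_label ` {0, 1, 2, 3} \<longleftrightarrow> {a, b, c, d} = {0, 1, 2, 3}"
    by (rule inj_on_image_eq_iff[OF inj assms]) auto
  then show ?thesis
    unfolding im by (simp add: door_def)
qed

lemma cube3_shift_label:
  assumes "\<And>x y z. x \<le> 1 \<Longrightarrow> y \<le> 1 \<Longrightarrow> z \<le> 1 \<Longrightarrow> h x y z \<le> 4"
  shows "cube3 (\<lambda>x y z. shift_label (h x y z)) = cube3 h"
  using assms by (simp add: cube3_def door_shift_label)

text \<open>If one label were missing from the corners, every 4-simplex of the cube would contribute zero.\<close>

lemma all_labels_if_cube4_odd:
  assumes odd: "cube4 h \<noteq> 0"
    and le: "\<And>x y z u. h x y z u \<le> 4" and "k \<le> 4"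
  shows "\<exists>x\<le>1. \<exists>y\<le>1. \<exists>z\<le>1. \<exists>u\<le>1. h x y z u = k"
proof (rule ccontr)
  assume k: "\<not> ?thesis"
  have "doors (h x0 y0 z0 u0) (h x1 y1 z1 u1) (h x2 y2 z2 u2) (h x3 y3 z3 u3) (h x4 y4 z4 u4) = 0"
    if "{x0, y0, z0, u0, x1, y1, z1, u1, x2, y2, z2, u2, x3, y3, z3, u3, x4, y4, z4, u4} \<subseteq> {..1}"
    for x0 y0 z0 u0 x1 y1 z1 u1 x2 y2 z2 u2 x3 y3 z3 u3 x4 y4 z4 u4
  proof (rule ccontr)
    assume "\<not> ?thesis"
    then have "{h x0 y0 z0 u0, h x1 y1 z1 u1, h x2 y2 z2 u2, h x3 y3 z3 u3, h x4 y4 z4 u4} = {..4}"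
      by (rule all_labels_if_doors_odd) (simp add: le)
    then have "k \<in> {h x0 y0 z0 u0, h x1 y1 z1 u1, h x2 y2 z2 u2, h x3 y3 z3 u3, h x4 y4 z4 u4}"
      using \<open>k \<le> 4\<close> by simp
    moreover have "h x y z u \<noteq> k" if "x \<le> 1" "y \<le> 1" "z \<le> 1" "u \<le> 1" for x y z u
      using k that by blast
    ultimately show False
      using that unfolding insert_subset atMost_iff by (elim insertE) (metis empty_iff)+
  qed
  then have "cube4 h = 0"
    by (simp add: cube4_def)
  with odd show False ..
qed

lemma sum_telescope_bit: "(\<Sum>i<p. f i + f (Suc i)) = f 0 + (f p :: bit)"
  by (induction p) (simp_all only: lessThan_0 sum.empty sum.lessThan_Suc add.assoc bit_self)

lemma sum_shift_periodic:
  fixes f :: "nat \<Rightarrow> 'a::comm_monoid_add"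
  assumes "\<And>t. f (t + p) = f t"
  shows "(\<Sum>t<p. f (t + q)) = (\<Sum>t<p. f t)"
proof (induction q)
  case (Suc q)
  have "(\<Sum>t<p. f (t + Suc q)) = (\<Sum>t<p. f (t + q))"
  proof (cases p)
    case (Suc n)
    have "(\<Sum>t<Suc n. f (t + q)) = f q + (\<Sum>t<n. f (t + Suc q))"
      by (simp only: sum.lessThan_Suc_shift) simp
    moreover have "f (n + Suc q) = f q"
      using assms[of q] Suc by (simp add: add.commute)
    ultimately show ?thesis
      using Suc by (simp add: add.commute)
  qed simp
  then show ?case using Suc by simp
qed simp

text \<open>The sum over all small cubes telescopes to the doors on the boundary of the large cube. At the
  faces with \<open>i = 0\<close> the labelling is degenerate, those with \<open>i = p\<close> and with \<open>s = p\<close> lack the label \<open>0\<close>,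
  the faces \<open>t = 0\<close> and \<open>t = p\<close> carry the same labels, and so do \<open>a = 0\<close> and \<open>a = p\<close> up to a translation
  in the periodic direction \<open>t\<close> and a cyclic shift, which permutes the labels \<open>0, 1, 2, 3\<close>. On the
  remaining face \<open>s = 0\<close> the labels \<open>0\<close> and \<open>3\<close> occur only along \<open>i = 0\<close>, where the labels run through
  \<open>0, 3, 2, 1\<close> as \<open>t\<close> increases. They are adjacent only once, between \<open>t = q - 1\<close> and \<open>t = q\<close>, and the only
  tetrahedron there that also has the labels \<open>1\<close> and \<open>2\<close> takes them from \<open>i = 1\<close>, with \<open>a = 0\<close>
  and \<open>a = 1\<close>. So exactly one door is left.\<close>

lemma twisted_sperner:
  fixes L :: "nat \<Rightarrow> nat \<Rightarrow> nat \<Rightarrow> nat \<Rightarrow> nat"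
  assumes p: "p = 4 * q" and q: "0 < q"
    and le: "\<And>i a t s. L i a t s \<le> 4"
    and per: "\<And>i a t s. L i a (t + p) s = L i a t s"
    and glue: "\<And>i t s. i \<le> p \<Longrightarrow> s \<le> p \<Longrightarrow> L i 0 (t + q) s = shift_label (L i p t s)"
    and centre: "\<And>a t s. L 0 a t s = L 0 0 t s"
    and rim: "\<And>a t s. a \<le> p \<Longrightarrow> s \<le> p \<Longrightarrow> L p a t s \<noteq> 0"
    and large: "\<And>i a t. i \<le> p \<Longrightarrow> a \<le> p \<Longrightarrow> L i a t p \<noteq> 0"
    and small: "\<And>i a t. i \<le> p \<Longrightarrow> a \<le> p \<Longrightarrow>
      L i a t 0 = (if i = 0 then (4 - t div q mod 4) mod 4 else if a = 0 then 1 else 2)"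
  shows "\<exists>i<p. \<exists>a<p. \<exists>t<p. \<exists>s<p.
    \<forall>k\<le>4. \<exists>x\<le>1. \<exists>y\<le>1. \<exists>z\<le>1. \<exists>u\<le>1. L (i + x) (a + y) (t + z) (s + u) = k"
proof (rule ccontr)
  assume no: "\<not> ?thesis"
  \<comment> \<open>The doors of a small facet orthogonal to the direction of \<open>i\<close>, \<open>a\<close>, \<open>t\<close> or \<open>s\<close>, respectively; the
    coordinate in that direction comes first, ready for telescoping.\<close>
  define F1 where "F1 i a t s = cube3 (\<lambda>x y z. L i (a + x) (t + y) (s + z))" for i a t s
  define F2 where "F2 a i t s = cube3 (\<lambda>x y z. L (i + x) a (t + y) (s + z))" for i a t s
  define F3 where "F3 t i a s = cube3 (\<lambda>x y z. L (i + x) (a + y) t (s + z))" for i a t s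
  define F4 where "F4 s i a t = cube3 (\<lambda>x y z. L (i + x) (a + y) (t + z) s)" for i a t s
  have cell: "(F1 i a t s + F1 (Suc i) a t s) + (F2 a i t s + F2 (Suc a) i t s)
     + (F3 t i a s + F3 (Suc t) i a s) + (F4 s i a t + F4 (Suc s) i a t) = 0"
    if "i < p" "a < p" "t < p" "s < p" for i a t s
  proof -
    have "cube4 (\<lambda>x y z u. L (i + x) (a + y) (t + z) (s + u)) = 0"
    proof (rule ccontr)
      assume odd: "\<not> ?thesis"
      have "\<forall>k\<le>4. \<exists>x\<le>1. \<exists>y\<le>1. \<exists>z\<le>1. \<exists>u\<le>1. L (i + x) (a + y) (t + z) (s + u) = k"
        using all_labels_if_cube4_odd[OF odd le] by (intro allI impI)
      then show False
        using no that by blast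
    qed
    then show ?thesis
      unfolding cube4_boundary F1_def F2_def F3_def F4_def by simp
  qed
  have "0 = (\<Sum>i<p. \<Sum>a<p. \<Sum>t<p. \<Sum>s<p. (F1 i a t s + F1 (Suc i) a t s)
     + (F2 a i t s + F2 (Suc a) i t s)
     + (F3 t i a s + F3 (Suc t) i a s) + (F4 s i a t + F4 (Suc s) i a t))"
    using cell by simp
  also have "\<dots> = (\<Sum>i<p. \<Sum>a<p. \<Sum>t<p. \<Sum>s<p. F1 i a t s + F1 (Suc i) a t s)
     + (\<Sum>i<p. \<Sum>a<p. \<Sum>t<p. \<Sum>s<p. F2 a i t s + F2 (Suc a) i t s)
     + (\<Sum>i<p. \<Sum>a<p. \<Sum>t<p. \<Sum>s<p. F3 t i a s + F3 (Suc t) i a s)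
     + (\<Sum>i<p. \<Sum>a<p. \<Sum>t<p. \<Sum>s<p. F4 s i a t + F4 (Suc s) i a t)"
    by (simp only: sum.distrib)
  also have "(\<Sum>i<p. \<Sum>a<p. \<Sum>t<p. \<Sum>s<p. F1 i a t s + F1 (Suc i) a t s) = 0"
  proof -
    have "F1 0 a t s = 0" for a t s
      unfolding F1_def by (rule cube3_eq_0_if_degenerate) (metis centre)
    moreover have "F1 p a t s = 0" if "a < p" "s < p" for a t s
      unfolding F1_def by (rule cube3_eq_0_if_no_0) (use rim that in simp)
    moreover have "(\<Sum>i<p. \<Sum>a<p. \<Sum>t<p. \<Sum>s<p. F1 i a t s + F1 (Suc i) a t s)
      = (\<Sum>a<p. \<Sum>t<p. \<Sum>s<p. F1 0 a t s) + (\<Sum>a<p. \<Sum>t<p. \<Sum>s<p. F1 p a t s)"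
      using sum_telescope_bit[of "\<lambda>i. \<Sum>a<p. \<Sum>t<p. \<Sum>s<p. F1 i a t s" p]
      by (simp only: sum.distrib)
    ultimately show ?thesis by simp
  qed
  also have "(\<Sum>i<p. \<Sum>a<p. \<Sum>t<p. \<Sum>s<p. F2 a i t s + F2 (Suc a) i t s) = 0"
  proof -
    have "F2 0 i (t + q) s = F2 p i t s" if "i < p" "s < p" for i t s
    proof -
      have "F2 0 i (t + q) s = cube3 (\<lambda>x y z. shift_label (L (i + x) p (t + y) (s + z)))"
        unfolding F2_def
      proof (rule cube3_cong)
        fix x y z :: nat assume "x \<le> 1" "y \<le> 1" "z \<le> 1"
        then show "L (i + x) 0 (t + q + y) (s + z) = shift_label (L (i + x) p (t + y) (s + z))"
          using glue[of "i + x" "s + z" "t + y"] that by (simp add: add_ac)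
      qed
      also have "\<dots> = F2 p i t s"
        unfolding F2_def by (rule cube3_shift_label) (rule le)
      finally show ?thesis .
    qed
    moreover have "(\<Sum>t<p. F2 0 i (t + q) s) = (\<Sum>t<p. F2 0 i t s)" for i s
    proof (rule sum_shift_periodic)
      show "F2 0 i (t + p) s = F2 0 i t s" for t
        unfolding F2_def using per[of _ _ "t + _"] by (simp add: add_ac)
    qed
    ultimately have eq: "(\<Sum>t<p. F2 p i t s) = (\<Sum>t<p. F2 0 i t s)" if "i < p" "s < p" for i s
      using that by (metis (no_types, lifting) sum.cong)
    have "(\<Sum>a<p. \<Sum>t<p. \<Sum>s<p. F2 a i t s + F2 (Suc a) i t s)
      = (\<Sum>s<p. \<Sum>t<p. F2 0 i t s) + (\<Sum>s<p. \<Sum>t<p. F2 p i t s)" for i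
      using sum_telescope_bit[of "\<lambda>a. \<Sum>s<p. \<Sum>t<p. F2 a i t s" p]
      by (simp only: sum.distrib sum.swap[of "\<lambda>t s. F2 _ i t s"])
    moreover have "(\<Sum>s<p. \<Sum>t<p. F2 p i t s) = (\<Sum>s<p. \<Sum>t<p. F2 0 i t s)" if "i < p" for i
      by (rule sum.cong[OF refl]) (simp only: eq that lessThan_iff)
    ultimately have "(\<Sum>a<p. \<Sum>t<p. \<Sum>s<p. F2 a i t s + F2 (Suc a) i t s) = 0" if "i < p" for i
      using that by (simp only: bit_self)
    then show ?thesis
      by (intro sum.neutral) simp
  qed
  also have "(\<Sum>i<p. \<Sum>a<p. \<Sum>t<p. \<Sum>s<p. F3 t i a s + F3 (Suc t) i a s) = 0"
  proof -
    have "F3 p = F3 0"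
      unfolding F3_def using per[of _ _ 0] by simp
    moreover have "(\<Sum>t<p. \<Sum>s<p. F3 t i a s + F3 (Suc t) i a s)
      = (\<Sum>s<p. F3 0 i a s) + (\<Sum>s<p. F3 p i a s)" for i a
      using sum_telescope_bit[of "\<lambda>t. \<Sum>s<p. F3 t i a s" p]
      by (simp only: sum.distrib)
    ultimately have "(\<Sum>t<p. \<Sum>s<p. F3 t i a s + F3 (Suc t) i a s) = 0" for i a
      by (simp only: bit_self)
    then show ?thesis
      by (intro sum.neutral) simp
  qed
  also have "(\<Sum>i<p. \<Sum>a<p. \<Sum>t<p. \<Sum>s<p. F4 s i a t + F4 (Suc s) i a t) = 1"
  proof -
    have "F4 p i a t = 0" if "i < p" "a < p" for i a t
      unfolding F4_def by (rule cube3_eq_0_if_no_0) (use large that in simp)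
    moreover have "F4 0 i a t = (if i = 0 then if a = 0 then if t = q - 1 then 1 else 0 else 0 else 0)"
      if "i < p" "a < p" "t < p" for i a t
    proof -
      \<comment> \<open>\<open>g\<close> gives the labels of this face for \<open>i = 0\<close>, and \<open>M\<close> those of the whole face.\<close>
      define g where "g t = (4 - t div q mod 4) mod 4" for t
      define M where "M x y z = (if x = 0 then g z else if y = 0 then 1 else 2)" for x y z :: nat
      have "F4 0 i a t = cube3 (\<lambda>x y z. M (i + x) (a + y) (t + z))"
        unfolding F4_def by (rule cube3_cong) (use that small in \<open>simp add: M_def g_def\<close>)
      also have "\<dots> = (if i = 0 \<and> a = 0 then door (g t) (g (Suc t)) 1 2 else 0)"
      proof (cases "i = 0")
        case False
        then show ?thesis
          by (simp add: M_def cube3_eq_0_if_no_0)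
      next
        case True
        then show ?thesis
          by (simp add: M_def cube3_def door_eq_0_if_repeated)
      qed
      also have "door (g t) (g (Suc t)) 1 2 = (if t = q - 1 then 1 else 0)"
      proof -
        have "t div q < 4"
          using \<open>t < p\<close> q by (simp add: p less_mult_imp_div_less)
        then have t4: "t div q = 0 \<or> t div q = 1 \<or> t div q = 2 \<or> t div q = 3"
          by linarith
        have Suc_div: "Suc t div q = (if Suc t mod q = 0 then Suc (t div q) else t div q)"
          by (rule div_Suc)
        have "t = q - 1 \<longleftrightarrow> t div q = 0 \<and> Suc t mod q = 0"
        proof
          assume "t = q - 1"
          then show "t div q = 0 \<and> Suc t mod q = 0"
            using q by simp
        next
          assume *: "t div q = 0 \<and> Suc t mod q = 0"
          then have "t < q" "q dvd Suc t"
            using q by (auto simp: div_eq_0_iff)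
          then show "t = q - 1"
            using dvd_imp_le[of q "Suc t"] by simp
        qed
        moreover have "g t = 0 \<longleftrightarrow> t div q = 0" "g t = 3 \<longleftrightarrow> t div q = 1"
          "g (Suc t) = 3 \<longleftrightarrow> Suc t div q = 1" "g (Suc t) = 0 \<longleftrightarrow> Suc t div q \<in> {0, 4}"
          using t4 Suc_div by (auto simp: g_def)
        moreover have "door x y 1 2 = (if x = 0 \<and> y = 3 \<or> x = 3 \<and> y = 0 then 1 else 0)" for x y
        proof -
          have "{x, y, 1, 2} = {0, 1, 2, 3} \<longleftrightarrow> x = 0 \<and> y = 3 \<or> x = 3 \<and> y = 0"
          proof
            assume "{x, y, 1, 2} = {0, 1, 2, 3}"
            then have "0 \<in> {x, y, 1, 2}" "3 \<in> {x, y, 1, 2}"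
              by simp_all
            then show "x = 0 \<and> y = 3 \<or> x = 3 \<and> y = 0"
              by auto
          qed auto
          then show ?thesis
            by (simp add: door_def)
        qed
        ultimately show ?thesis
          using t4 Suc_div by (auto split: if_splits)
      qed
      finally show ?thesis by simp
    qed
    ultimately have "(\<Sum>s<p. F4 s i a t + F4 (Suc s) i a t)
        = (if i = 0 then if a = 0 then if t = q - 1 then 1 else 0 else 0 else 0)"
      if "i < p" "a < p" "t < p" for i a t
      using that sum_telescope_bit[of "\<lambda>s. F4 s i a t" p] by (simp only: add_0_right)
    then have "(\<Sum>i<p. \<Sum>a<p. \<Sum>t<p. \<Sum>s<p. F4 s i a t + F4 (Suc s) i a t)
        = (\<Sum>i<p. \<Sum>a<p. \<Sum>t<p. if i = 0 then if a = 0 then if t = q - 1 then 1 else 0 else 0 else 0)"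
      by (intro sum.cong) simp_all
    also have "\<dots> = 1"
    proof -
      have t: "(\<Sum>t<p. if t = q - 1 then 1 else 0) = (1::bit)"
        using p q by (simp only: sum.delta finite_lessThan) simp
      have a: "(\<Sum>a<p. if a = 0 then 1 else 0) = (1::bit)"
        using p q by (simp only: sum.delta finite_lessThan) simp
      have "(\<Sum>t<p. if i = 0 then if a = 0 then if t = q - 1 then 1 else 0 else 0 else (0::bit))
          = (if i = 0 then if a = 0 then 1 else 0 else 0)" for i a :: nat
        by (cases "i = 0"; cases "a = 0") (simp_all only: simp_thms if_True if_False sum.neutral_const t)
      moreover have "(\<Sum>a<p. if i = 0 then if a = 0 then 1 else 0 else (0::bit))
          = (if i = 0 then 1 else 0)" for i :: nat
        by (cases "i = 0") (simp_all only: simp_thms if_True if_False sum.neutral_const a)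
      ultimately show ?thesis
        by (simp only: a)
    qed
    finally show ?thesis .
  qed
  finally show False by simp
qed
section \<open>Large squares\<close>

text \<open>Vertex \<open>k\<close> of the square with \<open>norm w = x\<close>, with the argument of \<open>w\<close> running through
  \<open>[- pi / 4, pi / 4]\<close> as \<open>y\<close> runs through the unit interval, with \<open>v\<close> of argument \<open>2 * pi * z\<close>, and with
  \<open>norm v\<close> running from \<open>1 / 3\<close>, where all vertices are in the open unit disc, to \<open>1 + sqrt 2\<close>.
  In this sector of \<open>w\<close>, vertex \<open>0\<close> is farthest from the origin and vertex \<open>2\<close> is nearest.\<close>

definition vertex :: "nat \<Rightarrow> real \<Rightarrow> real \<Rightarrow> real \<Rightarrow> real \<Rightarrow> complex" where
  "vertex k x y z u =
     of_real ((1 - u) / 3 + u * (1 + sqrt 2)) * cis (2 * pi * z)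
       * (of_real x * cis (pi / 2 * y - pi / 4) + \<i> ^ k)"

lemma vertex_periodic: "vertex k x y (z + 1) u = vertex k x y z u"
  by (simp add: vertex_def distrib_left flip: cis_mult)

lemma vertex_centre: "vertex k 0 y z u = vertex k 0 0 z u"
  by (simp add: vertex_def)

lemma vertex_add4: "vertex (k + 4) x y z u = vertex k x y z u"
  by (simp add: vertex_def power_add)

text \<open>Turning \<open>v\<close> by a right angle and \<open>w\<close> back by the same angle keeps the centre \<open>v * w\<close> and renumbers
  the vertices. So the two ends of the sector describe the same squares.\<close>

lemma vertex_glue: "vertex k x 0 (z + 1/4) u = vertex (Suc k) x 1 z u"
proof -
  have "cis (2 * pi * (z + 1/4)) = cis (2 * pi * z) * \<i>"
    by (simp add: distrib_left flip: cis_mult)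
  moreover have "cis (pi / 2 * 1 - pi / 4) = \<i> * cis (pi / 2 * 0 - pi / 4)"
  proof -
    have "cis (pi / 2 * 1 - pi / 4) = cis (pi / 2) * cis (pi / 2 * 0 - pi / 4)"
      by (simp only: cis_mult) simp
    then show ?thesis by simp
  qed
  ultimately show ?thesis
    unfolding vertex_def by (simp add: algebra_simps del: cis_mult)
qed

lemma cos_sector:
  assumes "0 \<le> y" "y \<le> 1"
  shows "sqrt 2 / 2 \<le> cos (pi / 2 * y - pi / 4)"
proof -
  have "\<bar>pi / 2 * y - pi / 4\<bar> \<le> pi / 4"
    using assms by (simp add: abs_le_iff field_simps)
  then have "cos (pi / 4) \<le> cos \<bar>pi / 2 * y - pi / 4\<bar>"
    by (intro cos_monotone_0_pi_le) auto
  then show ?thesis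
    by (simp add: cos_45)
qed

lemma norm_vertex:
  assumes "0 \<le> u" "u \<le> 1"
  shows "norm (vertex k x y z u) =
    ((1 - u) / 3 + u * (1 + sqrt 2)) * norm (of_real x * cis (pi / 2 * y - pi / 4) + \<i> ^ k)"
proof -
  have "0 \<le> (1 - u) / 3 + u * (1 + sqrt 2)"
    using assms by simp
  then show ?thesis
    by (simp only: vertex_def norm_mult norm_of_real norm_cis abs_of_nonneg mult_1_right)
qed

lemma norm_vertex_small:
  assumes "0 \<le> x" "x \<le> 1"
  shows "norm (vertex k x y z 0) < 1"
proof -
  have "norm (of_real x * cis (pi / 2 * y - pi / 4) + \<i> ^ k) \<le> x + 1"
    using assms norm_triangle_ineq[of "of_real x * cis (pi / 2 * y - pi / 4)" "\<i> ^ k"]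
    by (simp add: norm_mult norm_power)
  then show ?thesis
    using assms by (simp add: norm_vertex)
qed

lemma norm_vertex_0_large:
  assumes "0 \<le> x" "0 \<le> y" "y \<le> 1"
  shows "1 + sqrt 2 \<le> norm (vertex 0 x y z 1)"
proof -
  have "1 \<le> Re (of_real x * cis (pi / 2 * y - pi / 4) + \<i> ^ 0)"
    using assms cos_sector[OF assms(2,3)] order_trans[of 0 "sqrt 2 / 2"] by simp
  then have "1 \<le> norm (of_real x * cis (pi / 2 * y - pi / 4) + \<i> ^ 0)"
    using complex_Re_le_cmod order_trans by blast
  then have "(1 + sqrt 2) * 1 \<le> (1 + sqrt 2) * norm (of_real x * cis (pi / 2 * y - pi / 4) + \<i> ^ 0)"
    by (rule mult_left_mono) simp
  then show ?thesis
    by (simp add: norm_vertex)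
qed

lemma norm_scaled_cis_pm_1_sq:
  "(norm (of_real x * cis t - 1))\<^sup>2 = x\<^sup>2 + 1 - 2 * x * cos t"
  "(norm (of_real x * cis t + 1))\<^sup>2 = x\<^sup>2 + 1 + 2 * x * cos t"
proof -
  have *: "(x * cos t)\<^sup>2 + (x * sin t)\<^sup>2 = x\<^sup>2"
    by (simp add: power_mult_distrib flip: distrib_left)
  show "(norm (of_real x * cis t - 1))\<^sup>2 = x\<^sup>2 + 1 - 2 * x * cos t"
    "(norm (of_real x * cis t + 1))\<^sup>2 = x\<^sup>2 + 1 + 2 * x * cos t"
    unfolding cmod_power2 using * by (simp_all add: power2_eq_square algebra_simps)
qed

lemma norm_vertex_2_le:
  assumes "0 \<le> x" "x \<le> 1" "0 \<le> y" "y \<le> 1" "0 \<le> u" "u \<le> 1"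
  shows "norm (vertex 2 x y z u) \<le> (1 - u) / 3 + u * (1 + sqrt 2)"
proof -
  have "x \<le> 2 * cos (pi / 2 * y - pi / 4)"
    using cos_sector[of y] assms real_sqrt_ge_1_iff[of 2] by linarith
  then have "x * x \<le> x * (2 * cos (pi / 2 * y - pi / 4))"
    using assms by (intro mult_left_mono)
  then have "(norm (of_real x * cis (pi / 2 * y - pi / 4) - 1))\<^sup>2 \<le> 1\<^sup>2"
    unfolding norm_scaled_cis_pm_1_sq by (simp add: power2_eq_square)
  then have "norm (of_real x * cis (pi / 2 * y - pi / 4) - 1) \<le> 1"
    by (rule power2_le_imp_le) simp
  then have "norm (of_real x * cis (pi / 2 * y - pi / 4) + \<i> ^ 2) \<le> 1"
    by simp
  moreover have "0 \<le> (1 - u) / 3 + u * (1 + sqrt 2)"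
    using assms by simp
  ultimately show ?thesis
    using assms mult_left_mono by (fastforce simp: norm_vertex)
qed

text \<open>The place where the ratio of the radii of the annulus matters: for \<open>norm w = 1\<close>, the squared
  distances of the vertices \<open>2\<close> and \<open>0\<close> are in the ratio of \<open>1 - C\<close> to \<open>1 + C\<close> with \<open>C \<ge> sqrt 2 / 2\<close>, which
  is at most \<open>1 / (1 + sqrt 2)\<^sup>2\<close>.\<close>

lemma norm_vertex_2_less_1:
  assumes "0 \<le> y" "y \<le> 1" "0 \<le> u" "u \<le> 1" "norm (vertex 0 1 y z u) < 1 + sqrt 2"
  shows "norm (vertex 2 1 y z u) < 1"
proof -
  define w where "w = cis (pi / 2 * y - pi / 4)"
  define C where "C = cos (pi / 2 * y - pi / 4)"
  have "sqrt 2 / 2 * (4 + 2 * sqrt 2) \<le> C * (4 + 2 * sqrt 2)"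
    using cos_sector[OF assms(1,2)] unfolding C_def by (rule mult_right_mono) simp
  then have "(1 + sqrt 2)\<^sup>2 * (2 - 2 * C) \<le> 2 + 2 * C"
    by (simp add: power2_eq_square algebra_simps)
  moreover have "(norm (w - 1))\<^sup>2 = 2 - 2 * C" "(norm (w + 1))\<^sup>2 = 2 + 2 * C"
    using norm_scaled_cis_pm_1_sq[of 1 "pi / 2 * y - pi / 4"] by (simp_all add: w_def C_def)
  ultimately have "(1 + sqrt 2)\<^sup>2 * (norm (w - 1))\<^sup>2 \<le> (norm (w + 1))\<^sup>2"
    by simp
  then have "(1 + sqrt 2) * norm (w - 1) \<le> norm (w + 1)"
    unfolding power_mult_distrib[symmetric] by (rule power2_le_imp_le) simp
  moreover have "0 \<le> (1 - u) / 3 + u * (1 + sqrt 2)"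
    using assms by simp
  ultimately have "((1 - u) / 3 + u * (1 + sqrt 2)) * ((1 + sqrt 2) * norm (w - 1))
    \<le> ((1 - u) / 3 + u * (1 + sqrt 2)) * norm (w + 1)"
    by (rule mult_left_mono)
  then have "(1 + sqrt 2) * norm (vertex 2 1 y z u) \<le> norm (vertex 0 1 y z u)"
    using assms by (simp add: norm_vertex w_def mult_ac)
  also have "\<dots> < (1 + sqrt 2) * 1"
    using assms by simp
  finally show ?thesis
    using mult_less_cancel_left_pos[of "1 + sqrt 2"] by (simp add: add_pos_nonneg)
qed

section \<open>The labelling of large squares\<close>

definition first_such :: "(nat \<Rightarrow> bool) \<Rightarrow> nat list \<Rightarrow> nat" where
  "first_such P ks = (case find P ks of None \<Rightarrow> 4 | Some k \<Rightarrow> k)"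

text \<open>The order in which the vertices are tried as labels at a grid point. It is \<open>2, 3, 1, 0\<close> for
  \<open>0 < i\<close> and \<open>0 < a\<close>. At \<open>a = 0\<close> the gluing with \<open>a = p\<close> forces the shifted order \<open>1, 2, 0, 3\<close>. In
  both orders \<open>2\<close> precedes \<open>0\<close>, which by \<open>norm_vertex_2_less_1\<close> prevents the label \<open>0\<close> for \<open>norm w = 1\<close>. For
  \<open>i = 0\<close> the square does not depend on \<open>a\<close>, and neither may the order; it is compatible with the gluing
  because it shifts by one after every quarter turn of \<open>v\<close>. The number \<open>4 - t div q mod 4\<close> is \<open>- (t div q)\<close>
  modulo 4.\<close>

definition preference :: "nat \<Rightarrow> nat \<Rightarrow> nat \<Rightarrow> nat \<Rightarrow> nat list" where
  "preference q i a t =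
     (if i = 0 then map (\<lambda>n. (n + (4 - t div q mod 4)) mod 4) [0, 1, 2, 3]
      else if a = 0 then [1, 2, 0, 3] else [2, 3, 1, 0])"

lemma set_preference: "set (preference q i a t) = {0, 1, 2, 3}"
proof (cases "i = 0")
  case True
  consider "t div q mod 4 = 0" | "t div q mod 4 = 1" | "t div q mod 4 = 2" | "t div q mod 4 = 3"
    by linarith
  then show ?thesis
    using True by cases (simp_all add: preference_def insert_commute flip: numeral_2_eq_2)
next
  case False
  then show ?thesis
    by (simp add: preference_def insert_commute)
qed

lemma first_such_cases:
  assumes "set ks = {0, 1, 2, 3}"
  shows "first_such P ks = 4 \<and> (\<forall>k<4. \<not> P k) \<or> first_such P ks < 4 \<and> P (first_such P ks)"
proof (cases "find P ks")
  case None
  then have "\<forall>k\<in>{0, 1, 2, 3}. \<not> P k"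
    unfolding find_None_iff assms[symmetric] by blast
  moreover have "k \<in> {0, 1, 2, 3}" if "k < 4" for k :: nat
    using that by auto
  ultimately have "\<forall>k<4. \<not> P k"
    by blast
  then show ?thesis
    using None by (simp add: first_such_def)
next
  case (Some k)
  then obtain j where "j < length ks" "P (ks ! j)" "k = ks ! j"
    using find_Some_iff[of P ks k] by blast
  then have "P k" "k \<in> {0, 1, 2, 3}"
    unfolding assms[symmetric] by simp_all
  then show ?thesis
    using Some by (auto simp: first_such_def)
qed

lemma first_such_glue:
  assumes q: "0 < q" and a: "0 < a" and P: "P 4 = P 0"
  shows "first_such (\<lambda>k. P (Suc k)) (preference q i 0 (t + q))
       = shift_label (first_such P (preference q i a t))"
proof (cases "i = 0")
  case False
  then show ?thesis
    using a P by (simp add: first_such_def preference_def shift_label_def flip: numeral_2_eq_2)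
next
  case True
  have step: "(t + q) div q mod 4 = Suc (t div q mod 4) mod 4"
    using q by (simp add: mod_Suc_eq)
  consider "t div q mod 4 = 0" | "t div q mod 4 = 1" | "t div q mod 4 = 2" | "t div q mod 4 = 3"
    by linarith
  then show ?thesis
    using True P
    by cases (simp_all only: preference_def step, simp_all add: first_such_def shift_label_def flip: numeral_2_eq_2)
qed

text \<open>A cube of the grid that carries all five labels: \<open>\<phi>\<close> takes a negative value at each of the four
  vertices for some corner of the cube, and for one corner it is nonnegative at all of them.\<close>

lemma near_common_zero:
  fixes \<phi> :: "complex \<Rightarrow> real"
  assumes neg: "\<And>z. norm z < 1 \<Longrightarrow> \<phi> z < 0"
    and pos: "\<And>z. 1 + sqrt 2 \<le> norm z \<Longrightarrow> 0 \<le> \<phi> z"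
    and q: "0 < q" and p: "p = 4 * q"
  obtains i a t s where "i < p" "a < p" "t < p" "s < p"
    "\<forall>k<4. \<exists>x\<le>1. \<exists>y\<le>1. \<exists>z\<le>1. \<exists>u\<le>1.
       \<phi> (vertex k (real (i + x) / p) (real (a + y) / p) (real (t + z) / p) (real (s + u) / p)) < 0"
    "\<exists>x\<le>1. \<exists>y\<le>1. \<exists>z\<le>1. \<exists>u\<le>1. \<forall>k<4. 0 \<le>
       \<phi> (vertex k (real (i + x) / p) (real (a + y) / p) (real (t + z) / p) (real (s + u) / p))"
proof -
  define N where "N i a t s k \<longleftrightarrow> \<phi> (vertex k (real i / p) (real a / p) (real t / p) (real s / p)) < 0"
    for i a t s k :: nat
  define L where "L i a t s = first_such (N i a t s) (preference q i a t)" for i a t s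
  have p0: "0 < p" using p q by simp
  have L_cases: "L i a t s = 4 \<and> (\<forall>k<4. \<not> N i a t s k) \<or> L i a t s < 4 \<and> N i a t s (L i a t s)"
    for i a t s
    unfolding L_def by (rule first_such_cases[OF set_preference])
  have N_neg: "L i a t s = k \<Longrightarrow> k < 4 \<Longrightarrow> N i a t s k" for i a t s k
    using L_cases[of i a t s] by auto
  have N_per: "N i a (t + p) s = N i a t s" for i a t s
    using p0 vertex_periodic[of _ _ _ "real t / p"] by (simp add: N_def fun_eq_iff add_divide_distrib)
  have N_glue: "N i 0 (t + q) s = (\<lambda>k. N i p t s (Suc k))" for i t s
  proof -
    have "real (t + q) / p = real t / p + 1 / 4"
      using p q by (simp add: field_simps)
    then show ?thesis
      using p0 vertex_glue[of _ _ "real t / p"] by (simp add: N_def fun_eq_iff)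
  qed
  have N_centre: "N 0 a t s = N 0 0 t s" for a t s
    using vertex_centre[of _ "real a / p"] by (simp add: N_def fun_eq_iff)
  have N_4: "N i a t s 4 = N i a t s 0" for i a t s
    using vertex_add4[of 0] by (simp add: N_def)
  have "\<exists>i<p. \<exists>a<p. \<exists>t<p. \<exists>s<p.
    \<forall>k\<le>4. \<exists>x\<le>1. \<exists>y\<le>1. \<exists>z\<le>1. \<exists>u\<le>1. L (i + x) (a + y) (t + z) (s + u) = k"
  proof (rule twisted_sperner[OF p q])
    show "L i a t s \<le> 4" for i a t s
      using L_cases[of i a t s] by auto
    show "L i a (t + p) s = L i a t s" for i a t s
    proof -
      have "preference q i a (t + p) = preference q i a t"
        using p q by (simp add: preference_def)
      then show ?thesis
        by (simp only: L_def N_per)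
    qed
    show "L i 0 (t + q) s = shift_label (L i p t s)" for i t s
      unfolding L_def N_glue by (rule first_such_glue[OF q p0 N_4])
    show "L 0 a t s = L 0 0 t s" for a t s
      by (simp add: L_def N_centre[of a] preference_def)
    show "L p a t s \<noteq> 0" if "a \<le> p" "s \<le> p" for a t s
    proof -
      have "N p a t s 2" if "N p a t s 0"
      proof -
        have "\<not> 0 \<le> \<phi> (vertex 0 1 (real a / p) (real t / p) (real s / p))"
          using that p0 by (simp add: N_def)
        then have "norm (vertex 0 1 (real a / p) (real t / p) (real s / p)) < 1 + sqrt 2"
          by (metis pos not_le)
        then have "norm (vertex 2 1 (real a / p) (real t / p) (real s / p)) < 1"
          using \<open>a \<le> p\<close> \<open>s \<le> p\<close> p0 by (intro norm_vertex_2_less_1) auto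
        then show ?thesis
          using neg p0 by (simp add: N_def)
      qed
      then show ?thesis
        using p0 by (cases "a = 0") (simp_all add: L_def preference_def first_such_def)
    qed
    show "L i a t p \<noteq> 0" if "i \<le> p" "a \<le> p" for i a t
    proof -
      have "\<not> N i a t p 0"
        using that p0 pos by (simp add: N_def norm_vertex_0_large not_less)
      then show ?thesis
        using N_neg[of i a t p 0] by auto
    qed
    show "L i a t 0 = (if i = 0 then (4 - t div q mod 4) mod 4 else if a = 0 then 1 else 2)"
      if "i \<le> p" "a \<le> p" for i a t
    proof -
      have N: "N i a t 0 k" for k
        using that p0 neg by (simp add: N_def norm_vertex_small)
      have "first_such P (k # ks) = k" if "P k" for P k ks
        using that by (simp add: first_such_def)
      note head = this[of "N i a t 0", OF N]
      show ?thesis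
        unfolding L_def preference_def by (simp only: list.map head add_0_left split: if_split) simp
    qed
  qed
  then obtain i a t s where lt: "i < p" "a < p" "t < p" "s < p"
    and all: "\<forall>k\<le>4. \<exists>x\<le>1. \<exists>y\<le>1. \<exists>z\<le>1. \<exists>u\<le>1. L (i + x) (a + y) (t + z) (s + u) = k"
    by blast
  show thesis
  proof (rule that[OF lt])
    show "\<forall>k<4. \<exists>x\<le>1. \<exists>y\<le>1. \<exists>z\<le>1. \<exists>u\<le>1.
       \<phi> (vertex k (real (i + x) / p) (real (a + y) / p) (real (t + z) / p) (real (s + u) / p)) < 0"
    proof (intro allI impI)
      fix k :: nat
      assume "k < 4"
      then obtain x y z u where "x \<le> 1" "y \<le> 1" "z \<le> 1" "u \<le> 1"
        and "L (i + x) (a + y) (t + z) (s + u) = k"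
        using all[rule_format, of k] by auto
      moreover from this have "N (i + x) (a + y) (t + z) (s + u) k"
        using N_neg \<open>k < 4\<close> by blast
      ultimately show "\<exists>x\<le>1. \<exists>y\<le>1. \<exists>z\<le>1. \<exists>u\<le>1.
         \<phi> (vertex k (real (i + x) / p) (real (a + y) / p) (real (t + z) / p) (real (s + u) / p)) < 0"
        unfolding N_def by blast
    qed
  next
    obtain x y z u where "x \<le> 1" "y \<le> 1" "z \<le> 1" "u \<le> 1"
      and 4: "L (i + x) (a + y) (t + z) (s + u) = 4"
      using all[rule_format, of 4] by auto
    moreover have "\<forall>k<4. \<not> N (i + x) (a + y) (t + z) (s + u) k"
      using L_cases[of "i + x" "a + y" "t + z" "s + u"] 4 by simp
    ultimately show "\<exists>x\<le>1. \<exists>y\<le>1. \<exists>z\<le>1. \<exists>u\<le>1. \<forall>k<4. 0 \<le>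
       \<phi> (vertex k (real (i + x) / p) (real (a + y) / p) (real (t + z) / p) (real (s + u) / p))"
      unfolding N_def not_less by blast
  qed
qed

text \<open>If no large square had \<open>\<phi>\<close> equal to zero at all vertices, the sum of the absolute values would
  have a positive minimum \<open>\<epsilon>\<close> by compactness. On a grid so fine that each value changes by less than
  \<open>\<epsilon> / 4\<close> within one cube, this contradicts the preceding lemma.\<close>

lemma square_of_zeros:
  fixes \<phi> :: "complex \<Rightarrow> real"
  assumes cont: "continuous_on UNIV \<phi>"
    and neg: "\<And>z. norm z < 1 \<Longrightarrow> \<phi> z < 0"
    and pos: "\<And>z. 1 + sqrt 2 \<le> norm z \<Longrightarrow> 0 \<le> \<phi> z"
  obtains c v where "1 \<le> norm v" "\<And>k. \<phi> (c + \<i> ^ k * v) = 0"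
proof -
  define Q :: "(real \<times> real \<times> real \<times> real) set" where "Q = {0..1} \<times> {0..1} \<times> {0..1} \<times> {0..1}"
  define \<Phi> where "\<Phi> k w = \<phi> (case w of (x, y, z, u) \<Rightarrow> vertex k x y z u)" for k w
  have "compact Q"
    by (simp add: Q_def compact_Times)
  have cont\<Phi>: "continuous_on Q (\<Phi> k)" for k
    unfolding \<Phi>_def vertex_def case_prod_beta
    by (rule continuous_on_compose2[OF cont]) (auto intro!: continuous_intros)
  have "\<exists>w\<in>Q. (\<Sum>k<4. \<bar>\<Phi> k w\<bar>) = 0"
  proof (rule ccontr)
    assume no: "\<not> ?thesis"
    have "continuous_on Q (\<lambda>w. \<Sum>k<4. \<bar>\<Phi> k w\<bar>)"
      by (intro continuous_intros cont\<Phi>)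
    moreover have "Q \<noteq> {}"
      by (auto simp: Q_def)
    ultimately obtain w0 where w0: "w0 \<in> Q" "\<And>w. w \<in> Q \<Longrightarrow> (\<Sum>k<4. \<bar>\<Phi> k w0\<bar>) \<le> (\<Sum>k<4. \<bar>\<Phi> k w\<bar>)"
      using continuous_attains_inf[OF \<open>compact Q\<close>] by blast
    define \<epsilon> where "\<epsilon> = (\<Sum>k<4. \<bar>\<Phi> k w0\<bar>)"
    have "\<epsilon> \<noteq> 0"
      using no w0(1) by (auto simp: \<epsilon>_def)
    then have "0 < \<epsilon>"
      unfolding \<epsilon>_def by (metis abs_ge_zero sum_nonneg order_le_less)
    have "\<exists>d>0. \<forall>w\<in>Q. \<forall>w'\<in>Q. dist w' w < d \<longrightarrow> dist (\<Phi> k w') (\<Phi> k w) < \<epsilon> / 4" for k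
      using compact_uniformly_continuous[OF cont\<Phi> \<open>compact Q\<close>, of k,
          unfolded uniformly_continuous_on_def, THEN spec, of "\<epsilon> / 4"] \<open>0 < \<epsilon>\<close>
      by simp
    then obtain d where d: "\<And>k. 0 < d k"
      "\<And>k w w'. w \<in> Q \<Longrightarrow> w' \<in> Q \<Longrightarrow> dist w' w < d k \<Longrightarrow> dist (\<Phi> k w') (\<Phi> k w) < \<epsilon> / 4"
      by metis
    define \<delta> where "\<delta> = Min (d ` {..<4::nat})"
    have "0 < \<delta>"
      unfolding \<delta>_def using d(1) by (subst Min_gr_iff) (auto simp: lessThan_empty_iff)
    have \<delta>: "\<delta> \<le> d k" if "k < 4" for k
      using that by (simp add: \<delta>_def)
    obtain q :: nat where q: "1 / \<delta> < q"
      using reals_Archimedean2 by blast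
    then have "0 < q"
      using \<open>0 < \<delta>\<close> by (metis divide_pos_pos less_trans of_nat_0_less_iff zero_less_one)
    define p where "p = 4 * q"
    have "0 < p" and mesh: "4 / p < \<delta>"
      using q \<open>0 < q\<close> \<open>0 < \<delta>\<close> by (simp_all add: p_def field_simps)
    obtain i a t s where lt: "i < p" "a < p" "t < p" "s < p"
      and negk: "\<forall>k<4. \<exists>x\<le>1. \<exists>y\<le>1. \<exists>z\<le>1. \<exists>u\<le>1.
       \<phi> (vertex k (real (i + x) / p) (real (a + y) / p) (real (t + z) / p) (real (s + u) / p)) < 0"
      and posk: "\<exists>x\<le>1. \<exists>y\<le>1. \<exists>z\<le>1. \<exists>u\<le>1. \<forall>k<4. 0 \<le>
       \<phi> (vertex k (real (i + x) / p) (real (a + y) / p) (real (t + z) / p) (real (s + u) / p))"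
      by (rule near_common_zero[where \<phi> = \<phi>, OF _ _ \<open>0 < q\<close> p_def])
        (erule neg, erule pos, (rule that; assumption))
    define P where "P x y z u = (real (i + x) / p, real (a + y) / p, real (t + z) / p, real (s + u) / p)"
      for x y z u :: nat
    have P_Q: "P x y z u \<in> Q" if "x \<le> 1" "y \<le> 1" "z \<le> 1" "u \<le> 1" for x y z u
      using lt that \<open>0 < p\<close> by (simp add: P_def Q_def)
    have P_dist: "dist (P x y z u) (P x' y' z' u') < \<delta>"
      if "x \<le> 1" "y \<le> 1" "z \<le> 1" "u \<le> 1" "x' \<le> 1" "y' \<le> 1" "z' \<le> 1" "u' \<le> 1" for x y z u x' y' z' u'
    proof -
      have coord: "dist (real (n + m) / p) (real (n + m') / p) \<le> 1 / p" if "m \<le> 1" "m' \<le> 1" for n m m' :: nat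
        using that \<open>0 < p\<close> by (auto simp: dist_real_def le_Suc_eq simp flip: diff_divide_distrib)
      have prod: "dist (b, b') (c, c') \<le> dist b c + dist b' c'" for b c :: "'b::metric_space" and b' c' :: "'c::metric_space"
        by (simp add: dist_Pair_Pair sqrt_sum_squares_le_sum)
      have "dist (P x y z u) (P x' y' z' u') \<le> 1 / p + (1 / p + (1 / p + 1 / p))"
        unfolding P_def by (intro order_trans[OF prod] add_mono coord that)
      then show ?thesis
        using mesh by simp
    qed
    obtain x y z u where le: "x \<le> 1" "y \<le> 1" "z \<le> 1" "u \<le> 1"
      and nonneg: "\<And>k. k < 4 \<Longrightarrow> 0 \<le> \<Phi> k (P x y z u)"
      using posk unfolding \<Phi>_def P_def prod.case by blast
    define w where "w = P x y z u"
    have "w \<in> Q"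
      unfolding w_def by (rule P_Q[OF le])
    have "\<bar>\<Phi> k w\<bar> < \<epsilon> / 4" if k: "k < 4" for k
    proof -
      obtain x' y' z' u' where le': "x' \<le> 1" "y' \<le> 1" "z' \<le> 1" "u' \<le> 1"
        and neg': "\<Phi> k (P x' y' z' u') < 0"
        using negk[rule_format, OF k] unfolding \<Phi>_def P_def prod.case by blast
      have "dist w (P x' y' z' u') < d k"
        unfolding w_def using P_dist[OF le le'] \<delta>[OF k] by (rule less_le_trans)
      then have "dist (\<Phi> k w) (\<Phi> k (P x' y' z' u')) < \<epsilon> / 4"
        by (rule d(2)[OF P_Q[OF le'] \<open>w \<in> Q\<close>])
      then show ?thesis
        using nonneg[OF k] neg' by (simp add: w_def dist_real_def)
    qed
    then have "(\<Sum>k<4. \<bar>\<Phi> k w\<bar>) < (\<Sum>k<4::nat. \<epsilon> / 4)"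
      by (intro sum_strict_mono) (auto simp: lessThan_empty_iff)
    then show False
      using w0(2)[OF \<open>w \<in> Q\<close>] by (simp add: \<epsilon>_def)
  qed
  then obtain x y z u where Q: "(x, y, z, u) \<in> Q" and zero: "(\<Sum>k<4. \<bar>\<Phi> k (x, y, z, u)\<bar>) = 0"
    by (metis prod_cases4)
  define r where "r = (1 - u) / 3 + u * (1 + sqrt 2)"
  define v where "v = of_real r * cis (2 * pi * z)"
  define c where "c = v * (of_real x * cis (pi / 2 * y - pi / 4))"
  have vertex: "vertex k x y z u = c + \<i> ^ k * v" for k
    unfolding vertex_def c_def v_def r_def by (simp only: distrib_left mult.commute[of "\<i> ^ k"])
  have zero4: "\<phi> (c + \<i> ^ k * v) = 0" if "k < 4" for k
    using zero that by (auto simp: \<Phi>_def vertex sum_nonneg_eq_0_iff)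
  have zeros: "\<phi> (c + \<i> ^ k * v) = 0" for k
  proof -
    have "\<i> ^ k = \<i> ^ (4 * (k div 4) + k mod 4)"
      by simp
    also have "\<dots> = \<i> ^ (k mod 4)"
      unfolding power_add power_mult by simp
    finally show ?thesis
      using zero4[of "k mod 4"] by simp
  qed
  \<comment> \<open>A zero of \<open>\<phi>\<close> has norm at least 1, and vertex 2 is at distance at most \<open>r\<close> from the origin.\<close>
  have "1 \<le> norm (vertex 2 x y z u)"
    using neg[of "vertex 2 x y z u"] zeros[of 2] unfolding vertex by (metis less_irrefl not_le)
  also have "\<dots> \<le> r"
    unfolding r_def using Q by (intro norm_vertex_2_le) (auto simp: Q_def)
  also have "\<dots> \<le> norm v"
    by (simp add: v_def norm_mult)
  finally show thesis
    using zeros by (rule that)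
qed
section \<open>Squares in sets that separate the two ends of the annulus\<close>

text \<open>The signed distance from \<open>K\<close>, negative on the component of \<open>0\<close>, is continuous since the frontier
  of the component is contained in \<open>K\<close>. It is nonnegative from radius \<open>1 + sqrt 2\<close> on because a point outside
  \<open>K\<close> in that range is joined to infinity by a radial ray that avoids \<open>K\<close>.\<close>

lemma square_in_separating_compact:
  fixes K :: "complex set"
  assumes K: "compact K" "\<And>z. z \<in> K \<Longrightarrow> 1 \<le> norm z \<and> norm z \<le> 1 + sqrt 2"
    and sep: "0 \<in> inside K"
  obtains c v where "1 \<le> norm v" "\<And>k. c + \<i> ^ k * v \<in> K"
proof -
  define U where "U = connected_component_set (- K) 0"
  have 0: "0 \<in> - K" and bounded: "bounded U"
    using sep by (auto simp: inside_def U_def)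
  have "closed K"
    using K(1) by (rule compact_imp_closed)
  have "K \<noteq> {}"
    using sep by auto
  have "open U"
    unfolding U_def using \<open>closed K\<close> by (intro open_connected_component) auto
  have "frontier U \<subseteq> K"
    using frontier_of_connected_component_subset[of "- K" 0] frontier_subset_closed[OF \<open>closed K\<close>]
    by (auto simp: U_def frontier_complement)
  define \<phi> where "\<phi> z = (if z \<in> U then - infdist z K else infdist z K)" for z
  have "continuous_on (closure U \<union> - U) \<phi>"
    unfolding \<phi>_def
  proof (rule continuous_on_cases)
    show "\<forall>z. z \<in> closure U \<and> z \<notin> U \<or> z \<in> - U \<and> z \<in> U \<longrightarrow> - infdist z K = infdist z K"
    proof (intro allI impI)
      fix z assume "z \<in> closure U \<and> z \<notin> U \<or> z \<in> - U \<and> z \<in> U"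
      then have "z \<in> K"
        using \<open>frontier U \<subseteq> K\<close> \<open>open U\<close> by (auto simp: frontier_def interior_open)
      then show "- infdist z K = infdist z K" by simp
    qed
  qed (use \<open>open U\<close> in \<open>auto intro!: continuous_intros\<close>)
  then have "continuous_on UNIV \<phi>"
    using closure_subset[of U] by (metis Compl_partition Un_mono Un_UNIV_right subset_UNIV top.extremum_uniqueI order_refl)
  moreover have "\<phi> z < 0" if "norm z < 1" for z
  proof -
    have "ball 0 1 \<subseteq> U"
      unfolding U_def using K(2) by (intro connected_component_maximal) (auto simp: not_le[symmetric])
    then show ?thesis
      using that K(2)[of z] infdist_pos_not_in_closed[OF \<open>closed K\<close> \<open>K \<noteq> {}\<close>, of z]
      by (auto simp: \<phi>_def)
  qed
  moreover have "0 \<le> \<phi> z" if z: "1 + sqrt 2 \<le> norm z" for z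
  proof (cases "z \<in> K")
    case False
    have "z \<notin> U"
    proof
      assume "z \<in> U"
      have z0: "1 < norm z"
        using z by (smt (verit) real_sqrt_gt_0_iff)
      have ray: "(\<lambda>t. of_real t * z) ` {1..} \<subseteq> - K"
      proof (rule image_subsetI)
        fix t :: real assume "t \<in> {1..}"
        show "of_real t * z \<in> - K"
        proof (cases "t = 1")
          case False
          then have "1 < t" "0 < norm z"
            using \<open>t \<in> {1..}\<close> z0 by (simp, linarith)
          then have "1 * norm z < t * norm z"
            by (rule mult_strict_right_mono)
          then have "norm z < norm (of_real t * z)"
            using \<open>1 < t\<close> by (simp add: norm_mult)
          then show ?thesis
            using K(2) z by force
        qed (use \<open>z \<notin> K\<close> in simp)
      qed
      have "connected ((\<lambda>t. of_real t * z) ` {1..})"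
        by (intro connected_continuous_image continuous_intros connected_Ici)
      moreover have "z \<in> (\<lambda>t. of_real t * z) ` {1..}"
        by (rule image_eqI[of _ _ 1]) auto
      ultimately have "(\<lambda>t. of_real t * z) ` {1..} \<subseteq> connected_component_set (- K) z"
        using ray by (intro connected_component_maximal)
      also have "\<dots> = U"
        using \<open>z \<in> U\<close> unfolding U_def by (metis connected_component_eq)
      finally have sub: "(\<lambda>t. of_real t * z) ` {1..} \<subseteq> U" .
      obtain B where B: "\<And>w. w \<in> U \<Longrightarrow> norm w \<le> B"
        using bounded by (auto simp: bounded_iff)
      have "norm (of_real (max 1 (B + 1)) * z) \<le> B"
        by (intro B subsetD[OF sub] imageI) simp
      moreover have "max 1 (B + 1) * 1 \<le> max 1 (B + 1) * norm z"
        using z0 by (intro mult_left_mono) auto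
      ultimately show False
        by (simp add: norm_mult)
    qed
    then show ?thesis
      by (simp add: \<phi>_def infdist_nonneg)
  qed (simp add: \<phi>_def)
  ultimately obtain c v where v: "1 \<le> norm v" and zero: "\<And>k. \<phi> (c + \<i> ^ k * v) = 0"
    using square_of_zeros by metis
  have "c + \<i> ^ k * v \<in> K" for k
    using zero[of k] in_closed_iff_infdist_zero[OF \<open>closed K\<close> \<open>K \<noteq> {}\<close>]
    by (auto simp: \<phi>_def split: if_splits)
  with v show thesis
    by (rule that)
qed

section \<open>From the plane to the complex numbers\<close>

definition to_complex :: "real ^ 2 \<Rightarrow> complex" where
  "to_complex x = Complex (x $ 1) (x $ 2)"

lemma to_complex_diff: "to_complex (x - y) = to_complex x - to_complex y"
  by (simp add: to_complex_def complex_eq_iff)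

lemma norm_to_complex: "norm (to_complex x) = norm x"
  by (simp add: to_complex_def complex_norm norm_vec_def L2_set_def sum_2)

lemma inner_to_complex: "x \<bullet> y = to_complex x \<bullet> to_complex y"
  by (simp add: to_complex_def inner_vec_def inner_complex_def sum_2)

lemma inj_to_complex: "to_complex x = to_complex y \<longleftrightarrow> x = y"
  by (simp add: to_complex_def vec_eq_iff forall_2)

lemma continuous_on_to_complex: "continuous_on S to_complex"
  unfolding to_complex_def Complex_eq by (intro continuous_intros)

lemma is_square_if_to_complex:
  assumes x: "\<And>k. k < 4 \<Longrightarrow> to_complex (x k) = c + \<i> ^ k * v" and v: "v \<noteq> 0"
  shows "is_square (x 0) (x 1) (x 2) (x 3) (sqrt 2 * norm v)"
proof -
  have pts: "to_complex (x 0) = c + v" "to_complex (x 1) = c + \<i> * v"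
    "to_complex (x 2) = c - v" "to_complex (x 3) = c - \<i> * v"
    using x[of 0] x[of 1] x[of 2] x[of 3] by (simp_all add: power3_eq_cube)
  have norms: "norm (1 - \<i>) = sqrt 2" "norm (1 + \<i>) = sqrt 2"
    by (simp_all add: cmod_def)
  have "dist (x 0) (x 1) = norm ((1 - \<i>) * v)"
    by (simp add: dist_norm pts to_complex_diff algebra_simps del: One_nat_def flip: norm_to_complex)
  moreover have "dist (x 0) (x 3) = norm ((1 + \<i>) * v)"
    by (simp add: dist_norm pts to_complex_diff algebra_simps del: One_nat_def flip: norm_to_complex)
  moreover have "(x 1 - x 0) \<bullet> (x 3 - x 0) = 0"
    by (simp add: inner_to_complex to_complex_diff pts inner_complex_def algebra_simps del: One_nat_def)
  moreover have "x 2 - x 3 = x 1 - x 0"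
    by (simp add: to_complex_diff pts del: One_nat_def flip: inj_to_complex)
  ultimately show ?thesis
    using v by (simp add: is_square_def norm_mult norms)
qed

section \<open>Generators wind around the origin\<close>

lemma winding_number_full_circle:
  assumes "0 < r"
  shows "winding_number (part_circlepath 0 r s (s + 2 * pi)) 0 = 1"
proof -
  have "((\<lambda>w. 1 / (w - 0)) has_contour_integral \<i> * of_real (2 * pi)) (part_circlepath 0 r s (s + 2 * pi))"
  proof -
    have "((\<lambda>t. \<i>) has_integral (2 * pi) *\<^sub>R \<i>) {s..s + 2 * pi}"
      using has_integral_const_real[of \<i> s "s + 2 * pi"] by simp
    moreover have "(\<lambda>t. 1 / (0 + of_real r * cis t - 0) * of_real r * \<i> * cis t) = (\<lambda>t. \<i>)"
      using assms by (simp add: fun_eq_iff)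
    moreover have "(2 * pi) *\<^sub>R \<i> = \<i> * of_real (2 * pi)"
      by (simp add: scaleR_conv_of_real)
    ultimately show ?thesis
      by (subst has_contour_integral_part_circlepath_iff) (simp, simp only:)
  qed
  moreover have "0 \<notin> path_image (part_circlepath 0 r s (s + 2 * pi))"
    using assms by (auto simp: path_image_def part_circlepath_def)
  ultimately show ?thesis
    by (simp add: winding_number_valid_path contour_integral_unique)
qed

lemma winding_number_homotopy_class:
  fixes A :: "(real ^ 2) set"
  assumes A: "0 \<notin> to_complex ` A" and "q \<in> homotopy_class A p"
  shows "winding_number (to_complex \<circ> q) 0 = winding_number (to_complex \<circ> p) 0"
proof -
  have "homotopic_paths (- {0}) (to_complex \<circ> p) (to_complex \<circ> q)"
    using assms
    by (intro homotopic_paths_continuous_image[where S = A])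
      (auto simp: homotopy_class_def intro: continuous_on_to_complex)
  then show ?thesis
    by (metis winding_number_homotopic_paths)
qed

text \<open>The winding number about \<open>0\<close> is a homomorphism from the fundamental group, so it vanishes on the
  subgroup generated by a class on which it vanishes.\<close>

lemma winding_number_zero_if_generated:
  fixes A :: "(real ^ 2) set"
  assumes A: "0 \<notin> to_complex ` A" and a: "a \<in> A" and p: "p \<in> loops_at A a"
    and zero: "winding_number (to_complex \<circ> p) 0 = 0"
    and X: "X \<in> generate (fundamental_group A a) {homotopy_class A p}"
  obtains q where "q \<in> loops_at A a" "X = homotopy_class A q"
    "winding_number (to_complex \<circ> q) 0 = 0"
proof -
  let ?G = "fundamental_group A a"
  interpret group ?G
    by (rule group_fundamental_group[OF a])
  have path: "path (to_complex \<circ> q)" "0 \<notin> path_image (to_complex \<circ> q)" if "q \<in> loops_at A a" for q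
    using that A by (auto simp: loops_at_def path_image_compose
        intro!: path_continuous_image continuous_on_to_complex)
  have "\<exists>q\<in>loops_at A a. X = homotopy_class A q \<and> winding_number (to_complex \<circ> q) 0 = 0"
    using X
  proof (induction rule: generate.induct)
    case one
    have "linepath a a \<in> loops_at A a"
      using a by (simp add: loops_at_def)
    moreover have "to_complex \<circ> linepath a a = linepath (to_complex a) (to_complex a)"
      by (simp add: fun_eq_iff linepath_def to_complex_def complex_eq_iff algebra_simps)
    moreover have "winding_number (linepath (to_complex a) (to_complex a)) 0 = 0"
      using A a by (intro winding_number_trivial) auto
    ultimately show ?case
      unfolding fundamental_group_def by (intro bexI[of _ "linepath a a"]) (simp_all only: monoid.simps)
  next
    case (incl h)
    then show ?case
      using p zero by blast
  next
    case (inv h)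
    have rev: "reversepath p \<in> loops_at A a"
      using p by (simp add: loops_at_def)
    have "homotopic_paths A (reversepath p +++ p) (linepath a a)"
      using p homotopic_paths_linv[of p A] by (auto simp: loops_at_def)
    then have "homotopy_class A (reversepath p) \<otimes>\<^bsub>?G\<^esub> homotopy_class A p = \<one>\<^bsub>?G\<^esub>"
      using homotopy_class_eq_iff[OF loops_at_join[OF rev p]]
      by (simp add: fundamental_group_mult_class[OF rev p]) (simp add: fundamental_group_def)
    then have "inv\<^bsub>?G\<^esub> (homotopy_class A p) = homotopy_class A (reversepath p)"
      using p rev by (intro inv_equality) (auto simp: fundamental_group_def)
    then have "inv\<^bsub>?G\<^esub> h = homotopy_class A (reversepath p)"
      using inv by simp
    moreover have "to_complex \<circ> reversepath p = reversepath (to_complex \<circ> p)"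
      by (simp add: reversepath_def fun_eq_iff)
    then have "winding_number (to_complex \<circ> reversepath p) 0 = 0"
      using winding_number_reversepath[OF path[OF p]] zero by simp
    ultimately show ?case
      using rev by blast
  next
    case (eng h1 h2)
    then obtain q1 q2 where q: "q1 \<in> loops_at A a" "q2 \<in> loops_at A a"
      "h1 = homotopy_class A q1" "h2 = homotopy_class A q2"
      "winding_number (to_complex \<circ> q1) 0 = 0" "winding_number (to_complex \<circ> q2) 0 = 0"
      by blast
    have "winding_number (to_complex \<circ> (q1 +++ q2)) 0 = 0"
      using q path by (simp add: path_compose_join winding_number_join pathfinish_compose
          pathstart_compose loops_at_def)
    then show ?case
      using q loops_at_join fundamental_group_mult_class by blast
  qed
  then show thesis
    using that by blast
qed

text \<open>A loop with winding number 1, which shows that the winding number is not zero on the whole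
  fundamental group.\<close>

lemma circle_in_loops_at:
  fixes A :: "(real ^ 2) set"
  assumes a: "a \<in> A" "a \<noteq> 0" and A: "\<And>x. norm x = norm a \<Longrightarrow> x \<in> A"
  obtains p where "p \<in> loops_at A a" "winding_number (to_complex \<circ> p) 0 = 1"
proof -
  define s where "s = Arg (to_complex a)"
  define P where "P = part_circlepath 0 (norm a) s (s + 2 * pi)"
  define p :: "real \<Rightarrow> real ^ 2" where "p t = (\<chi> i. if i = 1 then Re (P t) else Im (P t)) " for t
  have P: "to_complex \<circ> p = P"
    by (auto simp: p_def to_complex_def fun_eq_iff complex_eq_iff)
  have "norm (P t) = norm a" for t
    by (simp add: P_def part_circlepath_def norm_mult)
  then have "p t \<in> A" for t
    using A P norm_to_complex by (metis comp_apply)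
  moreover have "path p"
  proof -
    have "continuous_on {0..1} P"
      using valid_path_part_circlepath valid_path_imp_path unfolding P_def path_def by blast
    then have "continuous_on {0..1} (\<lambda>t. if i = 1 then Re (P t) else Im (P t))" for i :: 2
      by (cases "i = 1") (simp_all add: continuous_on_Re continuous_on_Im)
    then show ?thesis
      unfolding path_def p_def by (rule continuous_on_vec_lambda)
  qed
  moreover have "P 0 = to_complex a" "P 1 = to_complex a"
  proof -
    have "of_real (norm a) * cis s = to_complex a"
      using rcis_cmod_Arg[of "to_complex a"] by (simp add: s_def rcis_def norm_to_complex)
    moreover have "cis (s + 2 * pi) = cis s"
      by (simp flip: cis_mult)
    moreover have "P t = of_real (norm a) * cis (s + 2 * pi * t)" for t
      by (simp add: P_def part_circlepath_def linepath_def cis_conv_exp algebra_simps)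
    ultimately show "P 0 = to_complex a" "P 1 = to_complex a"
      by simp_all
  qed
  ultimately have "p \<in> loops_at A a"
    using P inj_to_complex by (auto simp: loops_at_def path_image_def pathstart_def pathfinish_def)
  then show thesis
    using that P a winding_number_full_circle by (simp add: P_def)
qed

section \<open>Curves in the annulus inscribe squares\<close>

theorem theorem1p3:
  fixes A :: "(real ^ 2) set" and \<gamma> :: "complex \<Rightarrow> real ^ 2"
  assumes "A = {x. 1 \<le> norm x \<and> norm x \<le> 1 + sqrt 2}"
    and "continuous_on (sphere 0 1) \<gamma>"
    and "\<gamma> ` sphere 0 1 \<subseteq> A"
    and "represents_generator A \<gamma>"
  shows "\<exists>l. l \<ge> sqrt 2 \<and> inscribes_square \<gamma> l"
proof -
  define K where "K = to_complex ` \<gamma> ` sphere 0 1"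
  define p where "p = loop_of_curve \<gamma>"
  have "\<gamma> 1 \<in> \<gamma> ` sphere 0 1"
    by (rule imageI) simp
  then have a: "\<gamma> 1 \<in> A"
    using assms(3) by blast
  then have a0: "\<gamma> 1 \<noteq> 0"
    using assms(1) by auto
  have A: "0 \<notin> to_complex ` A"
  proof
    assume "0 \<in> to_complex ` A"
    then obtain x where "x \<in> A" "to_complex x = 0" by auto
    then show False
      using assms(1) norm_to_complex[of x] by simp
  qed
  have p: "p \<in> loops_at A (\<gamma> 1)"
    unfolding p_def by (rule loop_of_curve_in_loops_at[OF assms(2,3)])
  have "winding_number (to_complex \<circ> p) 0 \<noteq> 0"
  proof
    assume zero: "winding_number (to_complex \<circ> p) 0 = 0"
    have "x \<in> A" if "norm x = norm (\<gamma> 1)" for x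
      using that assms(1) a by simp
    then obtain c where c: "c \<in> loops_at A (\<gamma> 1)" "winding_number (to_complex \<circ> c) 0 = 1"
      using circle_in_loops_at[OF a a0] by metis
    then have "homotopy_class A c \<in> generate (fundamental_group A (\<gamma> 1)) {homotopy_class A p}"
      using assms(4) unfolding represents_generator_def p_def by (simp add: fundamental_group_def)
    then obtain q where q: "q \<in> loops_at A (\<gamma> 1)" "homotopy_class A c = homotopy_class A q"
      "winding_number (to_complex \<circ> q) 0 = 0"
      by (rule winding_number_zero_if_generated[OF A a p zero])
    have "c \<in> homotopy_class A q"
      using q(2) homotopy_class_eq_iff[OF q(1), of c] unfolding homotopy_class_def by blast
    then show False
      using winding_number_homotopy_class[OF A] c(2) q(3) by fastforce
  qed
  moreover have "path (to_complex \<circ> p)" "pathfinish (to_complex \<circ> p) = pathstart (to_complex \<circ> p)"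
    using p by (auto simp: loops_at_def pathfinish_compose pathstart_compose
        intro!: path_continuous_image continuous_on_to_complex)
  ultimately have "0 \<notin> outside (path_image (to_complex \<circ> p))"
    using winding_number_zero_in_outside by blast
  moreover have "path_image (to_complex \<circ> p) = K"
  proof -
    have "(\<lambda>t. cis (2 * pi * t)) ` {0..1} = sphere 0 1"
    proof
      show "sphere 0 1 \<subseteq> (\<lambda>t. cis (2 * pi * t)) ` {0..1}"
      proof
        fix z :: complex assume "z \<in> sphere 0 1"
        then have "z = cis (2 * pi * (Arg2pi z / (2 * pi)))"
          by (simp add: complex_norm_eq_1_exp cis_conv_exp)
        then show "z \<in> (\<lambda>t. cis (2 * pi * t)) ` {0..1}"
          using Arg2pi_ge_0[of z] Arg2pi_lt_2pi[of z]
          by (intro image_eqI[of _ _ "Arg2pi z / (2 * pi)"]) auto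
      qed
    qed auto
    then have "K = to_complex ` \<gamma> ` (\<lambda>t. cis (2 * pi * t)) ` {0..1}"
      by (simp add: K_def)
    then show ?thesis
      by (simp add: path_image_def p_def loop_of_curve_def image_image)
  qed
  moreover have "0 \<notin> K"
    using A assms(3) by (auto simp: K_def)
  ultimately have "0 \<in> inside K"
    by (auto simp: inside_def outside_def)
  moreover have "compact K"
    unfolding K_def using assms(2)
    by (intro compact_continuous_image continuous_on_to_complex) auto
  moreover have "1 \<le> norm z \<and> norm z \<le> 1 + sqrt 2" if "z \<in> K" for z
    using that assms(1,3) by (auto simp: K_def norm_to_complex)
  ultimately obtain c v where v: "1 \<le> norm v" and "\<And>k. c + \<i> ^ k * v \<in> K"
    using square_in_separating_compact by metis
  then have "\<forall>k. \<exists>x. x \<in> \<gamma> ` sphere 0 1 \<and> to_complex x = c + \<i> ^ k * v"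
    unfolding K_def by (metis imageE)
  then obtain x where x: "\<And>k. x k \<in> \<gamma> ` sphere 0 1" "\<And>k::nat. to_complex (x k) = c + \<i> ^ k * v"
    by metis
  have "is_square (x 0) (x 1) (x 2) (x 3) (sqrt 2 * norm v)"
    using x(2) v by (intro is_square_if_to_complex) auto
  then have "inscribes_square \<gamma> (sqrt 2 * norm v)"
    unfolding inscribes_square_def using x(1) by blast
  moreover have "sqrt 2 \<le> sqrt 2 * norm v"
    using v by simp
  ultimately show ?thesis by blast
qed

end
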